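(* Let $t>1$ be an integer and let $n\ge 0$ be an integer. Then $D_n(1,x)$ is a permutation polynomial over $\mathbb{Z}_{3^t}$ if and only if $n\equiv 2\pmod{24}$ or $n\equiv 14\pmod{24}$.
   Context: The $n$th reversed Dickson polynomial of the first kind (with parameter $1$) is the integer-coefficient polynomial $D_n(1,x)$ defined by $D_0(1,x)=2$, $D_1(1,x)=1$, $D_n(1,x)=D_{n-1}(1,x)-x\,D_{n-2}(1,x)$ for $n\ge 2$. $\mathbb{Z}_m$ is the ring of integers modulo $m$; an integer polynomial is a permutation polynomial over $\mathbb{Z}_m$ if the map it induces $\mathbb{Z}_m\to\mathbb{Z}_m$ is a bijection. *)

theory Defs
  imports "HOL-Number_Theory.Number_Theory" "HOL-Computational_Algebra.Polynomial"
begin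

fun rev_dickson :: "nat \<Rightarrow> int poly" where
  "rev_dickson 0 = [:2:]"
| "rev_dickson (Suc 0) = [:1:]"
| "rev_dickson (Suc (Suc n)) = rev_dickson (Suc n) - [:0, 1:] * rev_dickson n"

(* The carrier of residue_ring m consists of the representatives 0, ..., m - 1 of the residue
   classes, so the map induced by an integer polynomial is evaluation followed by reduction. *)
definition permutation_poly_mod :: "int \<Rightarrow> int poly \<Rightarrow> bool" where
  "permutation_poly_mod m f \<longleftrightarrow>
     bij_betw (\<lambda>a. poly f a mod m) (carrier (residue_ring m)) (carrier (residue_ring m))"

end

(* A polynomial permutes Z/p^t with t > 1 iff it permutes Z/p and its derivative has no zero mod p.
   The derivative of D_(n+2)(1,x) is -(n+2) times the reversed Dickson polynomial E_n of the second
   kind, so for p = 3 everything is decided by the values of D_n and E_(n-2) mod 3 at 0, 1, 2.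
   Mod 3, D_n equals 1 at 0 (for n > 0) and -(-1)^n at 1, and u_(n+4) = -u_n for both sequences at
   x = 2, so D_n permutes Z/3 iff n = 2 mod 4.  Since E_n(1,0) = 1 and E_(n+3)(1,1) = -E_n(1,1), the
   derivative of such a D_n has no zero mod 3 iff n = 2 mod 3. *)
theory Submission
  imports Defs
begin

section \<open>First-order Taylor expansion and permutation polynomials modulo
  \<open>m\<close>\<close>

lemma poly_taylor_dvd:
  fixes f :: "'a::idom poly"
  shows "h\<^sup>2 dvd poly f (a + h) - poly f a - h * poly (pderiv f) a"
proof (induction f)
  case 0
  then show ?case by simp
next
  case (pCons c f)
  then obtain q where q: "poly f (a + h) - poly f a - h * poly (pderiv f) a = h\<^sup>2 * q"
    by (elim dvdE)
  \<comment> \<open>Horner step: the remainder for \<open>pCons c f\<close> is \<open>a + h\<close>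
    times the remainder for \<open>f\<close>, plus a multiple of \<open>h\<^sup>2\<close>.\<close>
  have "poly (pCons c f) (a + h) - poly (pCons c f) a - h * poly (pderiv (pCons c f)) a
      = (a + h) * (poly f (a + h) - poly f a - h * poly (pderiv f) a) + h\<^sup>2 * poly (pderiv f) a"
    by (simp add: pderiv_pCons algebra_simps power2_eq_square)
  then show ?case unfolding q by simp
qed

lemma poly_cong_int:
  fixes f :: "int poly"
  assumes "[a = b] (mod m)"
  shows "[poly f a = poly f b] (mod m)"
proof (induction f)
  case (pCons c f)
  then show ?case using cong_add[OF cong_refl cong_mult[OF assms pCons.IH]] by simp
qed simp

lemma poly_mod_int: "poly f (a mod m) mod m = poly f a mod m" for a m :: int
  using poly_cong_int[of "a mod m" a m f] unfolding cong_def mod_mod_trivial by blast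

lemma carrier_residue_ring: "carrier (residue_ring m) = {0..m - 1}"
  by (simp add: residue_ring_def)

lemma permutation_poly_mod_iff_inj_on:
  assumes "m > 0"
  shows "permutation_poly_mod m f \<longleftrightarrow> inj_on (\<lambda>a. poly f a mod m) {0..m - 1}"
proof -
  have "(\<lambda>a. poly f a mod m) ` {0..m - 1} \<subseteq> {0..m - 1}" using assms by auto
  then show ?thesis
    unfolding permutation_poly_mod_def carrier_residue_ring bij_betw_def
    using endo_inj_surj finite_atLeastAtMost_int by blast
qed

lemma permutation_poly_mod_iff_inj:
  assumes "m > 0"
  shows "permutation_poly_mod m f
    \<longleftrightarrow> (\<forall>a b. [poly f a = poly f b] (mod m) \<longrightarrow> [a = b] (mod m))"
proof -
  have "permutation_poly_mod m f \<longleftrightarrow> inj_on (\<lambda>a. poly f a mod m) {0..m - 1}"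
    using assms by (rule permutation_poly_mod_iff_inj_on)
  also have "\<dots> \<longleftrightarrow> (\<forall>a b. [poly f a = poly f b] (mod m) \<longrightarrow> [a = b] (mod m))"
  proof (intro iffI allI impI)
    fix a b
    assume inj: "inj_on (\<lambda>a. poly f a mod m) {0..m - 1}"
      and ab: "[poly f a = poly f b] (mod m)"
    have "poly f (a mod m) mod m = poly f (b mod m) mod m"
      using ab by (simp add: cong_def poly_mod_int)
    moreover have "a mod m \<in> {0..m - 1}" "b mod m \<in> {0..m - 1}" using assms by simp_all
    ultimately have "a mod m = b mod m" using inj_onD[OF inj] by blast
    then show "[a = b] (mod m)" by (simp add: cong_def)
  next
    assume *: "\<forall>a b. [poly f a = poly f b] (mod m) \<longrightarrow> [a = b] (mod m)"
    show "inj_on (\<lambda>a. poly f a mod m) {0..m - 1}"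
    proof (rule inj_onI)
      fix a b
      assume "a \<in> {0..m - 1}" "b \<in> {0..m - 1}" "poly f a mod m = poly f b mod m"
      with * have "[a = b] (mod m)" unfolding cong_def by blast
      then show "a = b" using \<open>a \<in> _\<close> \<open>b \<in> _\<close> by (simp add: cong_def)
    qed
  qed
  finally show ?thesis .
qed

text \<open>The carrier is finite, so surjectivity suffices. This form, unlike the injective one,
  passes at once to divisors of \<open>m\<close>, because solutions \<open>a\<close> stay solutions
  under the weaker congruence.\<close>

lemma permutation_poly_mod_iff_surj:
  assumes "m > 0"
  shows "permutation_poly_mod m f \<longleftrightarrow> (\<forall>c. \<exists>a. [poly f a = c] (mod m))"
proof -
  have "permutation_poly_mod m f \<longleftrightarrow> (\<lambda>a. poly f a mod m) ` {0..m - 1} = {0..m - 1}"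
    unfolding permutation_poly_mod_def carrier_residue_ring bij_betw_def
    by (auto intro: eq_card_imp_inj_on)
  also have "\<dots> \<longleftrightarrow> (\<forall>c. \<exists>a. [poly f a = c] (mod m))"
  proof (intro iffI allI)
    fix c
    assume "(\<lambda>a. poly f a mod m) ` {0..m - 1} = {0..m - 1}"
    moreover have "c mod m \<in> {0..m - 1}" using assms by simp
    ultimately have "c mod m \<in> (\<lambda>a. poly f a mod m) ` {0..m - 1}" by blast
    then show "\<exists>a. [poly f a = c] (mod m)" unfolding cong_def by force
  next
    assume *: "\<forall>c. \<exists>a. [poly f a = c] (mod m)"
    have "c \<in> (\<lambda>a. poly f a mod m) ` {0..m - 1}" if c: "c \<in> {0..m - 1}" for c
    proof -
      obtain a where "[poly f a = c] (mod m)" using * by blast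
      then have "poly f (a mod m) mod m = c"
        using c by (simp add: cong_def poly_mod_int)
      then show ?thesis using assms by (intro image_eqI[of _ _ "a mod m"]) auto
    qed
    then show "(\<lambda>a. poly f a mod m) ` {0..m - 1} = {0..m - 1}" using assms by auto
  qed
  finally show ?thesis .
qed

lemma permutation_poly_mod_dvd:
  assumes "permutation_poly_mod m f" "d dvd m" "m > 0" "d > 0"
  shows "permutation_poly_mod d f"
  using assms by (meson permutation_poly_mod_iff_surj cong_dvd_modulus)

section \<open>Passing between a prime and its powers\<close>

lemma permutation_poly_mod_prime_power_lift:
  fixes p :: int
  assumes p: "prime p" and perm: "permutation_poly_mod p f"
    and deriv: "\<And>a. \<not> p dvd poly (pderiv f) a"
    and t: "t \<ge> 1"
  shows "permutation_poly_mod (p ^ t) f"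
  using t
proof (induction t rule: dec_induct)
  case base
  then show ?case using perm by simp
next
  case (step t)
  have p0: "p > 0" using p by (simp add: prime_gt_0_int)
  show ?case
    unfolding permutation_poly_mod_iff_inj[OF zero_less_power[OF p0]]
  proof (intro allI impI)
    fix a b
    assume ab: "[poly f a = poly f b] (mod p ^ Suc t)"
    then have "[poly f a = poly f b] (mod p ^ t)"
      by (rule cong_dvd_modulus) (simp add: le_imp_power_dvd)
    with step.IH have "[a = b] (mod p ^ t)"
      using permutation_poly_mod_iff_inj[of "p ^ t" f] p0 by simp
    then obtain k where k: "a = b + p ^ t * k"
      by (metis cong_iff_lin cong_sym)
    \<comment> \<open>Since \<open>t \<ge> 1\<close>, \<open>2 * t \<ge> t + 1\<close>, so the
      quadratic Taylor remainder vanishes modulo \<open>p ^ Suc t\<close>.\<close>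
    have "p ^ Suc t dvd (p ^ t * k)\<^sup>2"
    proof -
      have "p ^ Suc t dvd p ^ (t * 2)" using step.hyps by (intro le_imp_power_dvd) simp
      then show ?thesis by (simp add: power_mult_distrib power_mult)
    qed
    moreover have "(p ^ t * k)\<^sup>2 dvd poly f a - poly f b - p ^ t * k * poly (pderiv f) b"
      unfolding k by (rule poly_taylor_dvd)
    ultimately have "p ^ Suc t dvd poly f a - poly f b - p ^ t * k * poly (pderiv f) b"
      by (rule dvd_trans)
    moreover have "p ^ Suc t dvd poly f a - poly f b" using ab by (simp add: cong_iff_dvd_diff)
    ultimately have "p ^ Suc t dvd p ^ t * k * poly (pderiv f) b"
      by (metis dvd_diff_right_iff)
    \<comment> \<open>Only the linear term is left; cancelling \<open>p ^ t\<close> and using that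
      the derivative is nonzero mod \<open>p\<close> forces \<open>p dvd k\<close>.\<close>
    then have "p dvd k * poly (pderiv f) b" using p0 by (simp add: mult.assoc mult.commute)
    then have "p dvd k" using p deriv by (simp add: prime_dvd_mult_iff)
    then show "[a = b] (mod p ^ Suc t)"
      using p0 unfolding k by (simp add: cong_iff_dvd_diff mult.commute)
  qed
qed

text \<open>If \<open>p\<close> divided the derivative at \<open>a\<close>, the distinct residues
  \<open>a\<close> and \<open>a + p ^ (t - 1)\<close> would have the same image modulo
  \<open>p ^ t\<close>.\<close>

lemma permutation_poly_mod_prime_power_deriv:
  fixes p :: int
  assumes p: "prime p" and perm: "permutation_poly_mod (p ^ t) f" and t: "t > 1"
  shows "\<not> p dvd poly (pderiv f) a"
proof
  assume dvd: "p dvd poly (pderiv f) a"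
  have p1: "p > 1" using p by (simp add: prime_gt_1_int)
  obtain s where s: "t = Suc s" "s \<ge> 1" using t by (cases t) auto
  \<comment> \<open>Here \<open>t > 1\<close> enters: \<open>s \<ge> 1\<close> gives
    \<open>2 * s \<ge> s + 1 = t\<close>.\<close>
  have "p ^ t dvd (p ^ s)\<^sup>2"
    unfolding power_mult[symmetric] using s by (intro le_imp_power_dvd) simp
  then have "p ^ t dvd poly f (a + p ^ s) - poly f a - p ^ s * poly (pderiv f) a"
    using poly_taylor_dvd dvd_trans by blast
  moreover have "p ^ t dvd p ^ s * poly (pderiv f) a"
    using dvd s by (simp add: mult.commute)
  ultimately have "p ^ t dvd poly f (a + p ^ s) - poly f a"
    by (metis dvd_diff_left_iff)
  then have "[poly f (a + p ^ s) = poly f a] (mod p ^ t)"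
    by (simp add: cong_iff_dvd_diff)
  then have "[a + p ^ s = a] (mod p ^ t)"
    using perm permutation_poly_mod_iff_inj[of "p ^ t" f] p1 by simp
  then have "p ^ t dvd p ^ s" by (simp add: cong_iff_dvd_diff)
  then show False using p1 s by (simp add: dvd_power_iff_le)
qed

theorem permutation_poly_mod_prime_power_iff:
  fixes p :: int
  assumes "prime p" "t > 1"
  shows "permutation_poly_mod (p ^ t) f
    \<longleftrightarrow> permutation_poly_mod p f \<and> (\<forall>a. \<not> p dvd poly (pderiv f) a)"
proof -
  have "p > 0" using assms by (simp add: prime_gt_0_int)
  then have "permutation_poly_mod p f" if "permutation_poly_mod (p ^ t) f"
    using permutation_poly_mod_dvd[OF that, of p] assms by simp
  then show ?thesis
    using permutation_poly_mod_prime_power_deriv permutation_poly_mod_prime_power_lift assms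
    by (metis less_imp_le)
qed

section \<open>Both conditions for the prime 3, read off from the values at 0, 1, 2\<close>

lemma permutation_poly_mod_3_iff:
  "permutation_poly_mod 3 f \<longleftrightarrow>
    poly f 0 mod 3 \<noteq> poly f 1 mod 3 \<and> poly f 0 mod 3 \<noteq> poly f 2 mod 3 \<and>
    poly f 1 mod 3 \<noteq> poly f 2 mod 3"
proof -
  have "permutation_poly_mod 3 f \<longleftrightarrow> inj_on (\<lambda>a. poly f a mod 3) {0..2}"
    using permutation_poly_mod_iff_inj_on[of 3 f] by simp
  moreover have "{0..2::int} = {0, 1, 2}" by auto
  ultimately show ?thesis by auto
qed

lemma all_not_3_dvd_poly_iff:
  fixes f :: "int poly"
  shows "(\<forall>a. \<not> 3 dvd poly f a) \<longleftrightarrow> \<not> 3 dvd poly f 0 \<and> \<not> 3 dvd poly f 1 \<and> \<not> 3 dvd poly f 2"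
proof -
  have "3 dvd poly f a \<longleftrightarrow> 3 dvd poly f (a mod 3)" for a
    by (simp add: dvd_eq_mod_eq_0 poly_mod_int)
  moreover have "a mod 3 \<in> {0, 1, 2}" for a :: int by auto
  ultimately show ?thesis by (metis empty_iff insert_iff)
qed

section \<open>The second kind and the derivative of the first kind\<close>

fun rev_dickson2 :: "nat \<Rightarrow> int poly" where
  "rev_dickson2 0 = [:1:]"
| "rev_dickson2 (Suc 0) = [:1:]"
| "rev_dickson2 (Suc (Suc n)) = rev_dickson2 (Suc n) - [:0, 1:] * rev_dickson2 n"

text \<open>Both sides satisfy the same recurrence and agree at the two initial indices.\<close>

lemma rev_dickson_Suc: "rev_dickson (Suc n) = 2 * rev_dickson2 (Suc n) - rev_dickson2 n"
proof (induction n rule: rev_dickson2.induct)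
  case (3 n)
  then show ?case by (simp add: algebra_simps)
qed (simp_all add: numeral_poly)

lemma pderiv_rev_dickson:
  "pderiv (rev_dickson (Suc (Suc n))) = - of_nat (n + 2) * rev_dickson2 n"
proof (induction n rule: rev_dickson2.induct)
  case 1
  then show ?case by (simp add: pderiv_pCons pderiv_diff numeral_poly)
next
  case 2
  then show ?case by (simp add: pderiv_pCons pderiv_diff numeral_poly one_pCons)
next
  case (3 n)
  \<comment> \<open>The product rule on the recurrence leaves an extra term of the first kind;
    rewriting it by \<open>rev_dickson_Suc\<close> makes everything a combination of
    \<open>rev_dickson2 (Suc n)\<close> and \<open>rev_dickson2 n\<close>.\<close>
  have "pderiv (rev_dickson (Suc (Suc (Suc (Suc n)))))
      = pderiv (rev_dickson (Suc (Suc (Suc n)))) - [:0, 1:] * pderiv (rev_dickson (Suc (Suc n)))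
        - rev_dickson (Suc (Suc n))"
    unfolding rev_dickson.simps(3)[of "Suc (Suc n)"] pderiv_diff pderiv_mult
    by (simp add: pderiv_pCons del: rev_dickson.simps mult_pCons_left)
  also have "\<dots> = - of_nat (n + 4) * rev_dickson2 (Suc (Suc n))"
    unfolding 3
    unfolding rev_dickson_Suc rev_dickson2.simps(3)
    by (simp add: algebra_simps del: rev_dickson2.simps mult_pCons_left mult_pCons_right)
  finally show ?case by simp
qed

section \<open>Values of both sequences at 0, 1, 2 modulo 3\<close>

lemma poly_rev_dickson_0: "poly (rev_dickson (Suc n)) 0 = 1"
  by (induction n) auto

text \<open>At \<open>x = 1\<close> the characteristic polynomial \<open>y^2 - y + 1\<close> is
  \<open>(y + 1)^2\<close> mod 3, and the initial values 2, 1 give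
  \<open>2 * (-1)^n\<close>.\<close>

lemma poly_rev_dickson_1_mod_3: "poly (rev_dickson n) 1 mod 3 = (if even n then 2 else 1)"
proof (induction n rule: rev_dickson.induct)
  case (3 n)
  then show ?case by (auto split: if_splits) presburger+
qed simp_all

lemma poly_rev_dickson_2_dvd_iff: "3 dvd poly (rev_dickson n) 2 \<longleftrightarrow> n mod 4 = 2"
proof (induction n rule: less_induct)
  case (less n)
  consider "n < 4" | k where "n = Suc (Suc (Suc (Suc k)))"
    using nat_le_iff_add[of 4 n] by fastforce
  then show ?case
  proof cases
    case 1
    then have "n \<in> {0, Suc 0, Suc (Suc 0), Suc (Suc (Suc 0))}" by auto
    then show ?thesis by auto
  next
    case 2
    \<comment> \<open>Unfolding the recurrence down to indices \<open>k\<close> and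
      \<open>Suc k\<close> makes divisibility by 3 periodic with period 4; the initial values are 2,
      1, -3, -5.\<close>
    have "poly (rev_dickson n) 2 = 2 * poly (rev_dickson k) 2 - 3 * poly (rev_dickson (Suc k)) 2"
      unfolding 2 by simp
    then have "3 dvd poly (rev_dickson n) 2 \<longleftrightarrow> 3 dvd poly (rev_dickson k) 2" by presburger
    moreover have "n mod 4 = k mod 4" using 2 by presburger
    ultimately show ?thesis using less[of k] 2 by simp
  qed
qed

lemma poly_rev_dickson2_0: "poly (rev_dickson2 n) 0 = 1"
  by (induction n rule: rev_dickson2.induct) auto

text \<open>Since \<open>y^2 - y + 1\<close> divides \<open>y^3 + 1\<close>, the values at 1 change
  sign after three steps, even over the integers; they start 1, 1, 0.\<close>

lemma poly_rev_dickson2_1_dvd_iff: "3 dvd poly (rev_dickson2 n) 1 \<longleftrightarrow> n mod 3 = 2"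
proof (induction n rule: less_induct)
  case (less n)
  consider "n < 3" | k where "n = Suc (Suc (Suc k))"
    by (metis add_Suc add_0 le_iff_add not_less numeral_3_eq_3)
  then show ?case
  proof cases
    case 1
    then have "n \<in> {0, Suc 0, Suc (Suc 0)}" by auto
    then show ?thesis by auto
  next
    case 2
    have "poly (rev_dickson2 n) 1 = - poly (rev_dickson2 k) 1"
      unfolding 2 by simp
    moreover have "n mod 3 = k mod 3" using 2 by presburger
    ultimately show ?thesis using less[of k] 2 by simp
  qed
qed

text \<open>Same recurrence as for the first kind, hence the same period 4, but now the initial
  values are 1, 1, -1, -3.\<close>

lemma poly_rev_dickson2_2_dvd_iff: "3 dvd poly (rev_dickson2 n) 2 \<longleftrightarrow> n mod 4 = 3"
proof (induction n rule: less_induct)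
  case (less n)
  consider "n < 4" | k where "n = Suc (Suc (Suc (Suc k)))"
    using nat_le_iff_add[of 4 n] by fastforce
  then show ?case
  proof cases
    case 1
    then have "n \<in> {0, Suc 0, Suc (Suc 0), Suc (Suc (Suc 0))}" by auto
    then show ?thesis by auto
  next
    case 2
    have "poly (rev_dickson2 n) 2 = 2 * poly (rev_dickson2 k) 2 - 3 * poly (rev_dickson2 (Suc k)) 2"
      unfolding 2 by simp
    then have "3 dvd poly (rev_dickson2 n) 2 \<longleftrightarrow> 3 dvd poly (rev_dickson2 k) 2" by presburger
    moreover have "n mod 4 = k mod 4" using 2 by presburger
    ultimately show ?thesis using less[of k] 2 by simp
  qed
qed

section \<open>Conditions on \<open>n\<close> and their combination\<close>

lemma permutation_poly_mod_3_rev_dickson: "permutation_poly_mod 3 (rev_dickson n) \<longleftrightarrow> n mod 4 = 2"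
proof (cases n)
  case 0
  then show ?thesis by (simp add: permutation_poly_mod_3_iff)
next
  case (Suc m)
  have "permutation_poly_mod 3 (rev_dickson n) \<longleftrightarrow> even n \<and> poly (rev_dickson n) 2 mod 3 = 0"
  proof -
    \<comment> \<open>The value at 0 is 1, so the value at 1 must be 2, which means \<open>n\<close>
      is even; only 0 remains for the value at 2.\<close>
    have "1 \<noteq> r \<and> 2 \<noteq> r \<longleftrightarrow> r = 0" if "r = k mod 3" for r k :: int
      using that by presburger
    then show ?thesis
      unfolding permutation_poly_mod_3_iff poly_rev_dickson_1_mod_3
      by (simp add: Suc poly_rev_dickson_0 del: rev_dickson.simps)
  qed
  also have "\<dots> \<longleftrightarrow> even n \<and> n mod 4 = 2"
    using poly_rev_dickson_2_dvd_iff[of n] by (simp add: dvd_eq_mod_eq_0)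
  also have "\<dots> \<longleftrightarrow> n mod 4 = 2" by presburger
  finally show ?thesis .
qed

lemma all_not_3_dvd_pderiv_rev_dickson_iff:
  assumes "n mod 4 = 2"
  shows "(\<forall>a. \<not> 3 dvd poly (pderiv (rev_dickson n)) a) \<longleftrightarrow> n mod 3 = 2"
proof -
  obtain k where k: "n = Suc (Suc k)" using assms by (cases n rule: rev_dickson.cases) auto
  have eq: "poly (pderiv (rev_dickson n)) a = - (int n * poly (rev_dickson2 k) a)" for a
    unfolding k pderiv_rev_dickson by (simp add: algebra_simps)
  have prime3: "prime (3::int)" by simp
  have dvd_n: "3 dvd int n \<longleftrightarrow> 3 dvd n" by presburger
  \<comment> \<open>In fact \<open>k\<close> is a multiple of 4, so the second-kind factor is
    nonzero mod 3 at 2 as well as at 0; only the factor \<open>n\<close> and the point 1 impose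
    conditions.\<close>
  have "k mod 4 \<noteq> 3" using assms k by presburger
  then have "(\<forall>a. \<not> 3 dvd poly (pderiv (rev_dickson n)) a) \<longleftrightarrow> \<not> 3 dvd n \<and> k mod 3 \<noteq> 2"
    unfolding all_not_3_dvd_poly_iff
    unfolding eq dvd_minus_iff prime_dvd_mult_iff[OF prime3] dvd_n
    by (auto simp: poly_rev_dickson2_0 poly_rev_dickson2_1_dvd_iff poly_rev_dickson2_2_dvd_iff)
  also have "\<dots> \<longleftrightarrow> n mod 3 = 2" using k by presburger
  finally show ?thesis .
qed

theorem theorem3p27:
  fixes t n :: nat
  assumes "t > 1"
  shows "permutation_poly_mod (3 ^ t) (rev_dickson n) \<longleftrightarrow> [n = 2] (mod 24) \<or> [n = 14] (mod 24)"
proof -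
  have "permutation_poly_mod (3 ^ t) (rev_dickson n) \<longleftrightarrow> n mod 4 = 2 \<and> n mod 3 = 2"
    using permutation_poly_mod_prime_power_iff[of 3 t "rev_dickson n"] assms
      permutation_poly_mod_3_rev_dickson all_not_3_dvd_pderiv_rev_dickson_iff by auto
  also have "\<dots> \<longleftrightarrow> [n = 2] (mod 24) \<or> [n = 14] (mod 24)"
  proof -
    \<comment> \<open>The two conditions amount to \<open>n mod 12 = 2\<close>, which splits into
      two classes mod 24; all 24 residues are checked.\<close>
    have "n mod 4 = n mod 24 mod 4" "n mod 3 = n mod 24 mod 3" by (simp_all add: mod_mod_cancel)
    moreover have "n mod 24 \<in> set [0..<24]" by simp
    ultimately show ?thesis unfolding cong_def by (auto simp: upt_rec)
  qed
  finally show ?thesis .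
qed

end
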